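(* For any graphs $G$ and $H$, $\nu_I(G\circ H)=\alpha(G)\,\nu_I(H)$.
   Context: All graphs are finite and simple. A matching $M$ of a graph $G$ is an induced matching if no two distinct edges of $M$ are joined by an edge of $G$; $\nu_I(G)$ denotes the maximum cardinality of an induced matching in $G$. $\alpha(G)$ is the independence number of $G$. The lexicographic product $G\circ H$ has vertex set $V(G)\times V(H)$, and $(g,h)$, $(g',h')$ are adjacent if either $gg'\in E(G)$, or $g=g'$ and $hh'\in E(H)$.
   Formalization: The case where G has an edge and H has at least one vertex but no edge is excluded, since there the formula fails (e.g. G = K2, H = K1 gives 1 on the left and 0 on the right). *)

theory Defs
  imports Main
begin

record 'a sgraph =
  verts :: "'a set"
  edges :: "'a set set"

definition simple_graph :: "'a sgraph \<Rightarrow> bool" where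
  "simple_graph G \<longleftrightarrow>
     finite (verts G) \<and> (\<forall>e \<in> edges G. e \<subseteq> verts G \<and> card e = 2)"

definition adj :: "'a sgraph \<Rightarrow> 'a \<Rightarrow> 'a \<Rightarrow> bool" where
  "adj G x y \<longleftrightarrow> {x, y} \<in> edges G"

definition matching :: "'a sgraph \<Rightarrow> 'a set set \<Rightarrow> bool" where
  "matching G M \<longleftrightarrow>
     M \<subseteq> edges G \<and> (\<forall>e \<in> M. \<forall>f \<in> M. e \<noteq> f \<longrightarrow> e \<inter> f = {})"

definition induced_matching :: "'a sgraph \<Rightarrow> 'a set set \<Rightarrow> bool" where
  "induced_matching G M \<longleftrightarrow>
     matching G M \<and>
     (\<forall>e \<in> M. \<forall>f \<in> M. e \<noteq> f \<longrightarrow> \<not> (\<exists>x \<in> e. \<exists>y \<in> f. adj G x y))"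

definition independent_set :: "'a sgraph \<Rightarrow> 'a set \<Rightarrow> bool" where
  "independent_set G S \<longleftrightarrow>
     S \<subseteq> verts G \<and> (\<forall>x \<in> S. \<forall>y \<in> S. \<not> adj G x y)"

(* For a simple graph the two sets below are finite and contain 0, so Max is
   the actual maximum. *)

definition induced_matching_number :: "'a sgraph \<Rightarrow> nat" where
  "induced_matching_number G = Max {card M | M. induced_matching G M}"

definition independence_number :: "'a sgraph \<Rightarrow> nat" where
  "independence_number G = Max {card S | S. independent_set G S}"

definition lex_product :: "'a sgraph \<Rightarrow> 'b sgraph \<Rightarrow> ('a \<times> 'b) sgraph" where
  "lex_product G H =
     \<lparr> verts = verts G \<times> verts H,
       edges = {{(g, h), (g', h')} | g h g' h'.
                  (g, h) \<in> verts G \<times> verts H \<and> (g', h') \<in> verts G \<times> verts H \<and>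
                  (adj G g g' \<or> g = g' \<and> adj H h h')} \<rparr>"

lemma not_adj_self: "simple_graph G \<Longrightarrow> \<not> adj G x x"
  by (force simp: simple_graph_def adj_def)

lemma simple_graph_lex_product:
  assumes "simple_graph G" "simple_graph H"
  shows "simple_graph (lex_product G H)"
proof -
  have "card {(g, h), (g', h')} = 2" if "adj G g g' \<or> g = g' \<and> adj H h h'" for g h g' h'
    using that not_adj_self[OF assms(1)] not_adj_self[OF assms(2)]
    by (cases "(g, h) = (g', h')") auto
  then show ?thesis
    using assms by (auto simp: simple_graph_def lex_product_def)
qed

lemma adj_lex_product:
  assumes "(g, h) \<in> verts G \<times> verts H" "(g', h') \<in> verts G \<times> verts H"
  shows "adj (lex_product G H) (g, h) (g', h') \<longleftrightarrow> adj G g g' \<or> g = g' \<and> adj H h h'"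
proof
  assume "adj (lex_product G H) (g, h) (g', h')"
  then show "adj G g g' \<or> g = g' \<and> adj H h h'"
    by (auto simp: adj_def lex_product_def doubleton_eq_iff insert_commute)
next
  assume "adj G g g' \<or> g = g' \<and> adj H h h'"
  then show "adj (lex_product G H) (g, h) (g', h')"
    using assms unfolding adj_def[of "lex_product G H"] by (auto simp: lex_product_def)
qed

lemma finite_edges: "simple_graph G \<Longrightarrow> finite (edges G)"
  by (rule finite_subset[of _ "Pow (verts G)"]) (auto simp: simple_graph_def)

lemma induced_matching_number_ge:
  assumes "simple_graph G" "induced_matching G M"
  shows "card M \<le> induced_matching_number G"
proof -
  have "{card M | M. induced_matching G M} \<subseteq> card ` Pow (edges G)"
    by (auto simp: induced_matching_def matching_def)
  then have "finite {card M | M. induced_matching G M}"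
    using finite_edges[OF assms(1)] by (meson finite_Pow_iff finite_imageI finite_subset)
  then show ?thesis
    unfolding induced_matching_number_def using assms(2) by (auto intro: Max_ge)
qed

(* The product formula fails when G has an edge while H has vertices but no
   edge (e.g. G the one-edge graph, H a single vertex): the edges of G survive
   in the product, so the left-hand side is positive and the right-hand side
   is 0. *)
lemma lex_product_formula_fails:
  fixes G :: "'a sgraph" and H :: "'b sgraph"
  assumes "simple_graph G" "simple_graph H"
    and "edges G \<noteq> {}" "verts H \<noteq> {}" "edges H = {}"
  shows "induced_matching_number (lex_product G H)
           \<noteq> independence_number G * induced_matching_number H"
proof -
  have "{card M | M. induced_matching H M} = {0}"
    using assms(5) by (auto simp: induced_matching_def matching_def)
  then have zero: "induced_matching_number H = 0"
    by (simp add: induced_matching_number_def)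
  obtain e where e: "e \<in> edges G" using assms(3) by blast
  then obtain a b where ab: "e = {a, b}"
    using assms(1) by (auto simp: simple_graph_def card_2_iff)
  obtain h where h: "h \<in> verts H" using assms(4) by blast
  have "a \<in> verts G" "b \<in> verts G" "adj G a b"
    using e ab assms(1) by (auto simp: simple_graph_def adj_def)
  then have "adj (lex_product G H) (a, h) (b, h)"
    using h by (simp add: adj_lex_product)
  then have "induced_matching (lex_product G H) {{(a, h), (b, h)}}"
    by (simp add: induced_matching_def matching_def adj_def)
  from induced_matching_number_ge[OF simple_graph_lex_product[OF assms(1,2)] this]
  show ?thesis using zero by simp
qed

end

theory Submission
  imports Defs
begin

text \<open>
  Each edge \<open>e\<close> of an induced matching \<open>M\<close> of the product is assigned the first coordinate \<open>g\<close> of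
  one of its ends. The values \<open>g\<close> form an independent set of \<open>G\<close>. If two edges of \<open>M\<close> share the
  value \<open>g\<close>, then neither of them can leave the fibre over \<open>g\<close>, because an end outside the fibre
  would be adjacent to an end of the other edge. Hence the edges with value \<open>g\<close> are either a single
  edge or a copy of an induced matching of \<open>H\<close>. Conversely, copies of an induced matching of \<open>H\<close>
  over the points of an independent set of \<open>G\<close> form an induced matching of the product.
\<close>

section \<open>Extremal induced matchings and independent sets\<close>

lemma adj_sym: "adj G x y \<longleftrightarrow> adj G y x"
  by (simp add: adj_def insert_commute)

lemma simple_graph_edgeE:
  assumes "simple_graph G" "e \<in> edges G"
  obtains x y where "e = {x, y}" "x \<noteq> y" "x \<in> verts G" "y \<in> verts G" "adj G x y"
proof -
  obtain x y where xy: "e = {x, y}" "x \<noteq> y"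
    using assms by (auto simp: simple_graph_def card_2_iff)
  moreover have "e \<subseteq> verts G"
    using assms by (auto simp: simple_graph_def)
  ultimately show ?thesis
    using that assms(2) by (auto simp: adj_def)
qed

lemma induced_matching_edges: "induced_matching G M \<Longrightarrow> M \<subseteq> edges G"
  by (simp add: induced_matching_def matching_def)

lemma induced_matching_not_adj:
  "\<lbrakk>induced_matching G M; e \<in> M; f \<in> M; e \<noteq> f; x \<in> e; y \<in> f\<rbrakk> \<Longrightarrow> \<not> adj G x y"
  by (auto simp: induced_matching_def)

lemma induced_matching_disjoint:
  "\<lbrakk>induced_matching G M; e \<in> M; f \<in> M; x \<in> e; x \<in> f\<rbrakk> \<Longrightarrow> e = f"
  by (auto simp: induced_matching_def matching_def)

lemma induced_matching_attained:
  assumes "simple_graph G"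
  obtains M where "induced_matching G M" "card M = induced_matching_number G"
proof -
  let ?C = "{card M | M. induced_matching G M}"
  have "?C \<subseteq> card ` Pow (edges G)"
    by (auto dest: induced_matching_edges)
  then have "finite ?C"
    using finite_edges[OF assms] by (meson finite_Pow_iff finite_imageI finite_subset)
  moreover have "induced_matching G {}"
    by (simp add: induced_matching_def matching_def)
  ultimately have "induced_matching_number G \<in> ?C"
    unfolding induced_matching_number_def by (intro Max_in) blast+
  then show ?thesis using that by auto
qed

lemma finite_independent_cards:
  assumes "simple_graph G"
  shows "finite {card S | S. independent_set G S}"
proof -
  have "{card S | S. independent_set G S} \<subseteq> card ` Pow (verts G)"
    by (auto simp: independent_set_def)
  then show ?thesis
    using assms by (meson finite_Pow_iff finite_imageI finite_subset simple_graph_def)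
qed

lemma independence_number_ge:
  "\<lbrakk>simple_graph G; independent_set G S\<rbrakk> \<Longrightarrow> card S \<le> independence_number G"
  unfolding independence_number_def by (auto intro: Max_ge finite_independent_cards)

lemma independence_attained:
  assumes "simple_graph G"
  obtains S where "independent_set G S" "card S = independence_number G"
proof -
  have "independent_set G {}"
    by (simp add: independent_set_def)
  then have "independence_number G \<in> {card S | S. independent_set G S}"
    unfolding independence_number_def
    by (intro Max_in finite_independent_cards assms) blast
  then show ?thesis using that by auto
qed

section \<open>Edges of the product and the lower bound\<close>

lemma lex_product_edgeE:
  assumes "e \<in> edges (lex_product G H)"
  obtains g h g' h' where "e = {(g, h), (g', h')}"
    "g \<in> verts G" "h \<in> verts H" "g' \<in> verts G" "h' \<in> verts H"
    "adj G g g' \<or> g = g' \<and> adj H h h'"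
  using assms by (auto simp: lex_product_def)

text \<open>Copies over different points of \<open>S\<close> are not joined because those points are
  not adjacent in \<open>G\<close>. Copies over the same point come from distinct edges of
  \<open>N\<close>, so a join between them would already be a join in \<open>H\<close>.\<close>

lemma induced_matching_copies:
  assumes G: "simple_graph G" and H: "simple_graph H"
    and S: "independent_set G S" and N: "induced_matching H N"
  shows "induced_matching (lex_product G H) ((\<lambda>(g, e). {g} \<times> e) ` (S \<times> N))"
    (is "induced_matching ?P ?M")
proof -
  have SV: "S \<subseteq> verts G" and NE: "N \<subseteq> edges H"
    using S induced_matching_edges[OF N] by (auto simp: independent_set_def)
  then have NV: "e \<subseteq> verts H" if "e \<in> N" for e
    using that H by (auto simp: simple_graph_def)
  have "?M \<subseteq> edges ?P"
  proof clarify
    fix g e assume ge: "g \<in> S" "e \<in> N"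
    with NE obtain x y where xy: "e = {x, y}" "x \<in> verts H" "y \<in> verts H" "adj H x y"
      by (meson simple_graph_edgeE[OF H] subsetD)
    then have "adj ?P (g, x) (g, y)"
      using ge SV by (auto simp: adj_lex_product)
    moreover have "{g} \<times> e = {(g, x), (g, y)}"
      using xy by auto
    ultimately show "{g} \<times> e \<in> edges ?P"
      by (simp add: adj_def)
  qed
  moreover have "E \<inter> F = {} \<and> (\<forall>u \<in> E. \<forall>v \<in> F. \<not> adj ?P u v)"
    if EF: "E \<in> ?M" "F \<in> ?M" "E \<noteq> F" for E F
  proof -
    obtain g e where E: "E = {g} \<times> e" "g \<in> S" "e \<in> N"
      using EF(1) by auto
    obtain g' e' where F: "F = {g'} \<times> e'" "g' \<in> S" "e' \<in> N"
      using EF(2) by auto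
    have ne: "g = g' \<Longrightarrow> e \<noteq> e'"
      using EF(3) E(1) F(1) by blast
    have "\<not> adj ?P (g, x) (g', y)" if "x \<in> e" "y \<in> e'" for x y
    proof -
      have "\<not> adj G g g'"
        using S E(2) F(2) by (simp add: independent_set_def)
      moreover have "\<not> (g = g' \<and> adj H x y)"
        using induced_matching_not_adj[OF N E(3) F(3) ne that] by blast
      moreover have "(g, x) \<in> verts G \<times> verts H" "(g', y) \<in> verts G \<times> verts H"
        using that E(2,3) F(2,3) SV NV by blast+
      ultimately show ?thesis
        by (simp add: adj_lex_product)
    qed
    moreover have "E \<inter> F = {}"
      using induced_matching_disjoint[OF N E(3) F(3)] ne E(1) F(1) by blast
    ultimately show ?thesis
      using E(1) F(1) by simp
  qed
  ultimately show ?thesis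
    unfolding induced_matching_def matching_def by simp
qed

lemma induced_matching_number_lex_product_ge:
  assumes G: "simple_graph G" and H: "simple_graph H"
  shows "independence_number G * induced_matching_number H
           \<le> induced_matching_number (lex_product G H)"
proof -
  obtain S where S: "independent_set G S" "card S = independence_number G"
    using independence_attained[OF G] .
  obtain N where N: "induced_matching H N" "card N = induced_matching_number H"
    using induced_matching_attained[OF H] .
  \<comment> \<open>A product \<open>{g} \<times> e\<close> determines \<open>g\<close> and
    \<open>e\<close> only when \<open>e\<close> is nonempty.\<close>
  have "e \<noteq> {}" if "e \<in> N" for e
    using that induced_matching_edges[OF N(1)] H by (force simp: simple_graph_def)
  then have "inj_on (\<lambda>(g, e). {g} \<times> e) (S \<times> N)"
    by (auto simp: inj_on_def times_eq_iff)
  then have "card ((\<lambda>(g, e). {g} \<times> e) ` (S \<times> N)) = card S * card N"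
    by (simp add: card_image card_cartesian_product)
  then show ?thesis
    using induced_matching_number_ge[OF simple_graph_lex_product[OF G H]
        induced_matching_copies[OF G H S(1) N(1)]] S(2) N(2) by simp
qed

section \<open>The upper bound\<close>

lemma induced_matching_lex_product_not_adj:
  assumes "simple_graph G" "simple_graph H" "induced_matching (lex_product G H) M"
    and "e \<in> M" "f \<in> M" "e \<noteq> f" "u \<in> e" "v \<in> f"
  shows "\<not> adj G (fst u) (fst v)" "fst u = fst v \<Longrightarrow> \<not> adj H (snd u) (snd v)"
proof -
  have "e \<subseteq> verts G \<times> verts H" "f \<subseteq> verts G \<times> verts H"
    using simple_graph_lex_product[OF assms(1,2)] induced_matching_edges[OF assms(3)] assms(4,5)
    by (auto simp: simple_graph_def lex_product_def)
  then have "u \<in> verts G \<times> verts H" "v \<in> verts G \<times> verts H"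
    using assms(7,8) by auto
  moreover have "\<not> adj (lex_product G H) u v"
    using induced_matching_not_adj[OF assms(3-8)] .
  ultimately show "\<not> adj G (fst u) (fst v)" "fst u = fst v \<Longrightarrow> \<not> adj H (snd u) (snd v)"
    using adj_lex_product[of "fst u" "snd u" G H "fst v" "snd v"] by auto
qed

text \<open>Some end of \<open>f\<close> lies over \<open>g\<close>, so no end of \<open>e\<close>
  lies over a neighbour of \<open>g\<close>. As one end of \<open>e\<close> lies over
  \<open>g\<close>, the edge \<open>e\<close> cannot arise from adjacency in \<open>G\<close>; it
  must come from an edge of \<open>H\<close>.\<close>

lemma induced_matching_lex_product_fibre:
  assumes G: "simple_graph G" and H: "simple_graph H"
    and M: "induced_matching (lex_product G H) M"
    and ef: "e \<in> M" "f \<in> M" "e \<noteq> f" "g \<in> fst ` e" "g \<in> fst ` f"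
  obtains h h' where "e = {(g, h), (g, h')}" "adj H h h'"
proof -
  obtain x y x' y' where e: "e = {(x, y), (x', y')}" "adj G x x' \<or> x = x' \<and> adj H y y'"
    using induced_matching_edges[OF M] ef(1) by (blast elim: lex_product_edgeE)
  obtain v where v: "v \<in> f" "fst v = g"
    using ef(5) by auto
  have "\<not> adj G x g" "\<not> adj G x' g"
    using induced_matching_lex_product_not_adj(1)[OF G H M ef(1-3) _ v(1)] v(2) e(1) by fastforce+
  moreover have "g = x \<or> g = x'"
    using ef(4) e(1) by auto
  ultimately have "g = x" "g = x'" "adj H y y'"
    using e(2) adj_sym[of G x x'] by auto
  then show ?thesis
    using that e(1) by auto
qed

text \<open>A single edge meeting the fibre over \<open>g\<close> may leave it, and then its second
  coordinates need not form an edge of \<open>H\<close>. With at least two edges in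
  \<open>A\<close>, each has a partner that keeps it inside the fibre, so \<open>A\<close> projects
  to an induced matching of \<open>H\<close>.\<close>

lemma card_fibre_le:
  assumes G: "simple_graph G" and H: "simple_graph H"
    and M: "induced_matching (lex_product G H) M"
    and A: "A \<subseteq> M" "\<And>e. e \<in> A \<Longrightarrow> g \<in> fst ` e" "1 < card A"
  shows "card A \<le> induced_matching_number H"
proof -
  have fibre: "\<exists>h h'. e = {(g, h), (g, h')} \<and> adj H h h'" if "e \<in> A" for e
  proof -
    have "A \<noteq> {e}"
      using A(3) by auto
    then obtain f where "f \<in> A" "f \<noteq> e"
      using \<open>e \<in> A\<close> by auto
    then have "e \<in> M" "f \<in> M" "e \<noteq> f" "g \<in> fst ` e" "g \<in> fst ` f"
      using \<open>e \<in> A\<close> A(1,2) by auto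
    then show ?thesis
      by (rule induced_matching_lex_product_fibre[OF G H M]) blast
  qed
  \<comment> \<open>Being recoverable from its projection makes the projection injective on
    \<open>A\<close> and lets each set in \<open>N\<close> be lifted back to an edge of
    \<open>M\<close>.\<close>
  then have eq: "e = {g} \<times> snd ` e" if "e \<in> A" for e
    using that by fastforce
  then have inj: "inj_on ((`) snd) A"
    by (metis inj_onI)
  define N where "N = (`) snd ` A"
  have NM: "{g} \<times> E \<in> M" if "E \<in> N" for E
  proof -
    obtain e where "e \<in> A" "E = snd ` e"
      using \<open>E \<in> N\<close> unfolding N_def by blast
    then show ?thesis
      using eq[of e, symmetric] A(1) by auto
  qed
  have "E \<in> edges H" if "E \<in> N" for E
  proof -
    obtain e where e: "e \<in> A" "E = snd ` e"
      using \<open>E \<in> N\<close> unfolding N_def by blast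
    then show ?thesis
      using fibre[OF e(1)] by (auto simp: adj_def)
  qed
  moreover have "E \<inter> F = {}" if "E \<in> N" "F \<in> N" "E \<noteq> F" for E F
  proof (rule equals0I)
    \<comment> \<open>A common vertex lifts to a common vertex of two edges of the matching
      \<open>M\<close>.\<close>
    fix h assume "h \<in> E \<inter> F"
    then have "(g, h) \<in> {g} \<times> E" "(g, h) \<in> {g} \<times> F"
      by simp_all
    then have "{g} \<times> E = {g} \<times> F"
      by (rule induced_matching_disjoint[OF M NM[OF that(1)] NM[OF that(2)]])
    then show False
      using that(3) by (auto simp: times_eq_iff)
  qed
  moreover have "\<not> adj H x y" if "E \<in> N" "F \<in> N" "E \<noteq> F" "x \<in> E" "y \<in> F" for E F x y
    using induced_matching_lex_product_not_adj(2)[OF G H M NM[OF that(1)] NM[OF that(2)],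
        of "(g, x)" "(g, y)"] that(3-5) by (auto simp: times_eq_iff)
  ultimately have "induced_matching H N"
    unfolding induced_matching_def matching_def by auto
  from induced_matching_number_ge[OF H this] show ?thesis
    by (simp add: N_def card_image[OF inj])
qed

text \<open>This bounds the fibres that hold just one edge, to which \<open>card_fibre_le\<close>
  does not apply.\<close>

lemma induced_matching_number_pos:
  assumes "simple_graph G" "edges G \<noteq> {}"
  shows "1 \<le> induced_matching_number G"
proof -
  obtain e where "e \<in> edges G"
    using assms(2) by blast
  then have "induced_matching G {e}"
    by (simp add: induced_matching_def matching_def)
  from induced_matching_number_ge[OF assms(1) this] show ?thesis
    by simp
qed

lemma card_induced_matching_lex_product_le:
  assumes G: "simple_graph G" and H: "simple_graph H" and HE: "edges H \<noteq> {}"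
    and M: "induced_matching (lex_product G H) M"
  shows "card M \<le> independence_number G * induced_matching_number H"
proof -
  \<comment> \<open>An edge may have two first coordinates; an arbitrary one is chosen, so that the
    fibres of \<open>p\<close> partition \<open>M\<close>.\<close>
  define p where "p e = (SOME g. g \<in> fst ` e)" for e :: "('a \<times> 'b) set"
  have finM: "finite M"
    using finite_edges[OF simple_graph_lex_product[OF G H]] induced_matching_edges[OF M]
    by (rule finite_subset[rotated])
  have p: "p e \<in> fst ` e" if "e \<in> M" for e
  proof -
    have "e \<noteq> {}"
      using induced_matching_edges[OF M] that by (blast elim: lex_product_edgeE)
    then show ?thesis
      by (simp add: p_def some_in_eq)
  qed
  have "independent_set G (p ` M)"
  proof -
    have "p e \<in> verts G" if "e \<in> M" for e
    proof -
      have "e \<in> edges (lex_product G H)"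
        using induced_matching_edges[OF M] that by blast
      then show ?thesis
        using p[OF that] by (auto elim: lex_product_edgeE)
    qed
    moreover have "\<not> adj G (p e) (p f)" if "e \<in> M" "f \<in> M" for e f
    \<comment> \<open>Distinct edges may share a value of \<open>p\<close>; the induced condition on
      \<open>M\<close> then still applies, and only \<open>e = f\<close> needs the absence of
      loops.\<close>
    proof (cases "e = f")
      case True
      then show ?thesis using not_adj_self[OF G] by simp
    next
      case False
      then show ?thesis
        using induced_matching_lex_product_not_adj(1)[OF G H M that False] p that by fastforce
    qed
    ultimately show ?thesis
      by (auto simp: independent_set_def)
  qed
  then have indep: "card (p ` M) \<le> independence_number G"
    by (rule independence_number_ge[OF G])
  have fibre: "card {e \<in> M. p e = g} \<le> induced_matching_number H" for g
  proof (cases "1 < card {e \<in> M. p e = g}")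
    case True
    then show ?thesis
      by (intro card_fibre_le[OF G H M, of _ g]) (use p in auto)
  next
    case False
    then show ?thesis
      using induced_matching_number_pos[OF H HE] by simp
  qed
  have "card M = (\<Sum>g \<in> p ` M. card {e \<in> M. p e = g})"
    using sum.image_gen[OF finM, of "\<lambda>_. 1::nat" p] by simp
  also have "\<dots> \<le> card (p ` M) * induced_matching_number H"
    using sum_bounded_above[of "p ` M" "\<lambda>g. card {e \<in> M. p e = g}"] fibre by simp
  also have "\<dots> \<le> independence_number G * induced_matching_number H"
    using indep by (rule mult_right_mono) simp
  finally show ?thesis .
qed

text \<open>The hypothesis \<open>nondegenerate\<close> is the exact negation of the case refuted by
  \<open>lex_product_formula_fails\<close>.\<close>

theorem theorem3p1:
  fixes G :: "'a sgraph" and H :: "'b sgraph"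
  assumes "simple_graph G" and "simple_graph H"
    and nondegenerate: "edges H \<noteq> {} \<or> edges G = {} \<or> verts H = {}"
  shows "induced_matching_number (lex_product G H)
           = independence_number G * induced_matching_number H"
proof (rule antisym)
  obtain M where M: "induced_matching (lex_product G H) M"
      "card M = induced_matching_number (lex_product G H)"
    using induced_matching_attained[OF simple_graph_lex_product[OF assms(1,2)]] .
  show "induced_matching_number (lex_product G H)
          \<le> independence_number G * induced_matching_number H"
  proof (cases "edges H = {}")
    \<comment> \<open>By \<open>nondegenerate\<close>, here \<open>G\<close> has no edges or
      \<open>H\<close> has no vertices; either way the product is edgeless and the left-hand side is
      0.\<close>
    case True
    then have "edges (lex_product G H) = {}"
      using nondegenerate by (auto simp: lex_product_def adj_def)
    then have "M = {}"
      using induced_matching_edges[OF M(1)] by simp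
    then show ?thesis using M(2) by simp
  next
    case False
    then show ?thesis
      using card_induced_matching_lex_product_le[OF assms(1,2) _ M(1)] M(2) by simp
  qed
qed (rule induced_matching_number_lex_product_ge[OF assms(1,2)])

end
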